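(* Let $A$ be a real symmetric positive definite $n\times n$ matrix and let $0\leqslant i\leqslant n-1$. Then, for all $\lambda\in(0,1)$ and any $r>0$, $$\frac{\mathrm{D}_i\bigl((1-\lambda)A+\lambda\,rI_n\bigr)}{\mathrm{D}_{i+1}\bigl((1-\lambda)A+\lambda\,rI_n\bigr)}\geqslant(1-\lambda)\,\frac{\mathrm{D}_i(A)}{\mathrm{D}_{i+1}(A)}+\lambda\,\frac{\mathrm{D}_i(rI_n)}{\mathrm{D}_{i+1}(rI_n)}.$$ Equality for $0\leqslant i<n-1$, for some $\lambda\in(0,1)$, holds if and only if $A=\alpha I_n$ for some $\alpha>0$.
   Context: $I_n$ is the $n\times n$ identity matrix. For a real symmetric $n\times n$ matrix $A$, the mixed discriminants $\mathrm{D}_k(A)=\mathrm{D}_k(A;I_n)$, $0\leqslant k\leqslant n$, are defined by $\det(A+\mu I_n)=\sum_{k=0}^n\binom nk\mathrm{D}_k(A)\mu^k$ for all $\mu\geqslant0$. *)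

theory Defs
  imports "HOL-Analysis.Analysis" "HOL-Computational_Algebra.Polynomial"
begin

definition positive_definite :: "real^'n^'n \<Rightarrow> bool" where
  "positive_definite A \<longleftrightarrow> (\<forall>x. x \<noteq> 0 \<longrightarrow> 0 < x \<bullet> (A *v x))"

text \<open>The defining identity of the mixed discriminants determines \<open>D k\<close> only for \<open>k \<le> n\<close>;
  the second conjunct merely pins down the irrelevant values \<open>D k\<close> for \<open>k > n\<close>.\<close>

definition is_mixed_discs :: "real^'n^'n \<Rightarrow> (nat \<Rightarrow> real) \<Rightarrow> bool" where
  "is_mixed_discs A D \<longleftrightarrow>
     (\<forall>\<mu>\<ge>0. det (A + \<mu> *\<^sub>R mat 1) = (\<Sum>k=0..CARD('n). real (CARD('n) choose k) * D k * \<mu> ^ k)) \<and>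
     (\<forall>k>CARD('n). D k = 0)"

definition mixed_disc :: "nat \<Rightarrow> real^'n^'n \<Rightarrow> real" where
  "mixed_disc k A = (THE D. is_mixed_discs A D) k"

text \<open>The description above is proper: the family of mixed discriminants exists and is unique.\<close>

lemma ex_is_mixed_discs:
  fixes A :: "real^'n^'n"
  shows "\<exists>D. is_mixed_discs A D"
proof -
  define M :: "real poly^'n^'n" where "M = (\<chi> i j. [:A$i$j, if i = j then 1 else 0:])"
  have M_deg: "degree (M$i$j) \<le> 1" for i j
    by (simp add: M_def)
  have deg: "degree (det M) \<le> CARD('n)"
    unfolding det_def
  proof (rule degree_sum_le)
    show "finite {p. p permutes (UNIV :: 'n set)}" by (simp add: finite_permutations)
    fix p :: "'n \<Rightarrow> 'n"
    have "degree (\<Prod>i\<in>UNIV. M$i$p i) \<le> (\<Sum>i\<in>(UNIV::'n set). degree (M$i$p i))"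
      using degree_prod_sum_le[of UNIV "\<lambda>i. M$i$p i"] by (simp add: o_def)
    also have "\<dots> \<le> (\<Sum>i\<in>(UNIV::'n set). 1)" by (intro sum_mono M_deg)
    finally have 1: "degree (\<Prod>i\<in>UNIV. M$i$p i) \<le> CARD('n)" by simp
    show "degree (of_int (sign p) * (\<Prod>i\<in>UNIV. M$i$p i)) \<le> CARD('n)"
      using degree_mult_le[of "of_int (sign p)" "\<Prod>i\<in>UNIV. M$i$p i"] 1
      by simp
  qed
  have ev: "poly (det M) \<mu> = det (A + \<mu> *\<^sub>R mat 1)" for \<mu>
    unfolding det_def
    by (auto simp: poly_sum poly_prod M_def mat_def intro!: sum.cong prod.cong)
  define D where "D k = coeff (det M) k / real (CARD('n) choose k)" for k
  have "poly (det M) \<mu> = (\<Sum>k=0..CARD('n). real (CARD('n) choose k) * D k * \<mu> ^ k)" for \<mu>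
  proof -
    have "poly (det M) \<mu> = (\<Sum>k=0..CARD('n). coeff (det M) k * \<mu> ^ k)"
      unfolding poly_altdef using deg
      by (intro sum.mono_neutral_left) (auto simp: coeff_eq_0)
    also have "\<dots> = (\<Sum>k=0..CARD('n). real (CARD('n) choose k) * D k * \<mu> ^ k)"
      by (intro sum.cong) (auto simp: D_def)
    finally show ?thesis .
  qed
  then have "is_mixed_discs A D"
    by (simp add: is_mixed_discs_def ev[symmetric] D_def binomial_eq_0)
  then show ?thesis by blast
qed

lemma is_mixed_discs_unique:
  fixes A :: "real^'n^'n"
  assumes "is_mixed_discs A D" "is_mixed_discs A E"
  shows "D = E"
proof
  fix k
  define P where "P D = (\<Sum>k=0..CARD('n). monom (real (CARD('n) choose k) * D k) k)" for D
  have ev: "poly (P D) \<mu> = (\<Sum>k=0..CARD('n). real (CARD('n) choose k) * D k * \<mu> ^ k)" for D \<mu>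
    by (simp add: P_def poly_sum poly_monom)
  have "P D = P E"
  proof (rule ccontr)
    assume "P D \<noteq> P E"
    then have "finite {x. poly (P D - P E) x = 0}" by (intro poly_roots_finite) simp
    moreover have "{0..1} \<subseteq> {x. poly (P D - P E) x = 0}"
      using assms by (auto simp: ev is_mixed_discs_def)
    ultimately have "finite {0..1::real}" by (rule rev_finite_subset)
    then show False by (simp add: infinite_Icc)
  qed
  moreover have "coeff (P D) k = (if k \<le> CARD('n) then real (CARD('n) choose k) * D k else 0)" for D
    by (auto simp: P_def coeff_sum)
  ultimately have "k \<le> CARD('n) \<Longrightarrow> real (CARD('n) choose k) * D k = real (CARD('n) choose k) * E k"
    by (metis (full_types))
  then show "D k = E k"
    using assms by (cases "k \<le> CARD('n)") (auto simp: is_mixed_discs_def)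
qed

lemma mixed_disc_eq:
  assumes "is_mixed_discs A D"
  shows "mixed_disc k A = D k"
proof -
  have "(THE D. is_mixed_discs A D) = D"
    using assms is_mixed_discs_unique by blast
  then show ?thesis by (simp add: mixed_disc_def)
qed

lemma det_eq_sum_mixed_disc:
  fixes A :: "real^'n^'n"
  assumes "0 \<le> \<mu>"
  shows "det (A + \<mu> *\<^sub>R mat 1) = (\<Sum>k=0..CARD('n). real (CARD('n) choose k) * mixed_disc k A * \<mu> ^ k)"
proof -
  obtain D where D: "is_mixed_discs A D" using ex_is_mixed_discs by blast
  then show ?thesis
    using assms by (simp add: mixed_disc_eq[OF D] is_mixed_discs_def)
qed

end

theory Submission
  imports Defs "HOL-Computational_Algebra.Fundamental_Theorem_Algebra"
begin

text \<open>
  A symmetric positive definite \<open>A\<close> has \<open>det (A + \<mu>I) = \<Prod>j. x\<^sub>j + \<mu>\<close> with all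
  \<open>x\<^sub>j > 0\<close>. Write \<open>d\<^sub>k(s)\<close> for the mixed discriminants of \<open>A + sI\<close>. They satisfy
  \<open>d\<^sub>k' = (n - k) d\<^bsub>k+1\<^esub>\<close>, so \<open>f = d\<^sub>i / d\<^bsub>i+1\<^esub>\<close> has
  \<open>f' - 1 = (n - i - 1) (d\<^bsub>i+1\<^esub>\<^sup>2 - d\<^sub>i d\<^bsub>i+2\<^esub>) / d\<^bsub>i+1\<^esub>\<^sup>2\<close>, which is
  nonnegative by Newton's inequality. Hence \<open>f(s) \<ge> f(0) + s\<close>, and by homogeneity the claim is this
  inequality at \<open>s = \<lambda>r / (1 - \<lambda>)\<close>. If the \<open>x\<^sub>j\<close> are not all equal and \<open>i < n - 1\<close>, Newton's
  inequality is strict throughout; if they all equal \<open>c\<close>, the extreme values of the quadratic form of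
  \<open>A\<close> on the unit sphere, being eigenvalues, are both \<open>c\<close>, so \<open>A = cI\<close>.
\<close>

section \<open>Coefficient means and Newton's inequality\<close>

text \<open>With \<open>n = length xs\<close>, the coefficient of \<open>\<mu>\<^sup>k\<close> in \<open>\<Prod>x\<leftarrow>xs. x + \<mu>\<close> is
  \<open>n choose k\<close> times \<open>coeff_mean xs k\<close>. The recursion is Pascal's rule divided by \<open>n choose k\<close>.
  At \<open>k = 0\<close> the factor \<open>real k\<close> cancels the junk index \<open>k - 1\<close>.\<close>

fun coeff_mean :: "real list \<Rightarrow> nat \<Rightarrow> real" where
  "coeff_mean [] k = (if k = 0 then 1 else 0)"
| "coeff_mean (x # xs) k =
     ((real (Suc (length xs)) - real k) * x * coeff_mean xs k + real k * coeff_mean xs (k - 1))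
       / real (Suc (length xs))"

lemma coeff_mean_eq_0: "length xs < k \<Longrightarrow> coeff_mean xs k = 0"
  by (induction xs arbitrary: k) auto

lemma coeff_mean_length: "coeff_mean xs (length xs) = 1"
  by (induction xs) (auto simp: coeff_mean_eq_0)

lemma coeff_mean_pos:
  assumes "\<forall>x\<in>set xs. 0 < x" "k \<le> length xs"
  shows "0 < coeff_mean xs k"
  using assms
proof (induction xs arbitrary: k)
  case (Cons x xs)
  show ?case
  \<comment> \<open>At the top index the factor \<open>real (Suc (length xs)) - real k\<close>
    vanishes. Below it the first summand is strictly positive and the second at least
    nonnegative.\<close>
  proof (cases "k = Suc (length xs)")
    case True
    then show ?thesis using coeff_mean_length[of "x # xs"] by simp
  next
    case False
    with Cons.prems have "k \<le> length xs" by simp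
    moreover have "0 \<le> real k * coeff_mean xs (k - 1)"
      using Cons.prems \<open>k \<le> length xs\<close> Cons.IH[of "k - 1"] by (simp add: less_imp_le)
    ultimately show ?thesis
      using Cons by (auto intro!: divide_pos_pos add_pos_nonneg mult_pos_pos)
  qed
qed auto

lemma coeff_mean_nonneg: "\<forall>x\<in>set xs. 0 < x \<Longrightarrow> 0 \<le> coeff_mean xs k"
  by (cases "k \<le> length xs") (auto simp: coeff_mean_eq_0 intro: less_imp_le coeff_mean_pos)

text \<open>A factor \<open>[:x, 1:]\<close> sends coefficients \<open>c k\<close> to
  \<open>x * c k + c (k - 1)\<close>. The two absorption identities for binomials turn this into the
  recursion of \<open>coeff_mean\<close>.\<close>

lemma coeff_prod_linear_factors:
  "coeff (\<Prod>x\<leftarrow>xs. [:x, 1:]) k = real (length xs choose k) * coeff_mean xs k"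
proof (induction xs arbitrary: k)
  case Nil
  show ?case by (auto simp: coeff_1 split: nat.splits)
next
  case (Cons x xs)
  let ?n = "length xs"
  show ?case
  proof (cases k)
    case 0
    then show ?thesis using Cons.IH[of 0] by simp
  next
    case (Suc j)
    have "real (Suc j) * real (Suc ?n choose Suc j) = real (Suc ?n) * real (?n choose j)"
      by (metis Suc_times_binomial of_nat_mult)
    moreover have "(real (Suc ?n) - real (Suc j)) * real (Suc ?n choose Suc j)
        = real (Suc ?n) * real (?n choose Suc j)"
    proof (cases "j \<le> ?n")
      case True
      then show ?thesis using binomial_absorb_comp[of "Suc ?n" "Suc j"]
        by (metis Suc_le_mono diff_Suc_1 of_nat_diff of_nat_mult)
    qed (simp add: binomial_eq_0)
    ultimately have "real (Suc ?n) * (x * (real (?n choose Suc j) * coeff_mean xs (Suc j))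
          + real (?n choose j) * coeff_mean xs j)
        = real (Suc ?n) * (real (Suc ?n choose Suc j) * coeff_mean (x # xs) (Suc j))"
      by (simp add: field_simps del: binomial_Suc_Suc) algebra
    then show ?thesis using Cons.IH Suc
      by (simp del: binomial_Suc_Suc coeff_mean.simps)
  qed
qed

lemma prod_list_eq_sum_coeff_mean:
  "(\<Prod>x\<leftarrow>xs. x + \<mu>) = (\<Sum>k=0..length xs. real (length xs choose k) * coeff_mean xs k * \<mu> ^ k)"
proof -
  have "(\<Prod>x\<leftarrow>xs. x + \<mu>) = poly (\<Prod>x\<leftarrow>xs. [:x, 1:]) \<mu>"
    by (induction xs) (auto simp: algebra_simps)
  also have "degree (\<Prod>x\<leftarrow>xs. [:x, 1:]) \<le> length xs"
    by (rule degree_le) (simp add: coeff_prod_linear_factors binomial_eq_0)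
  then have "poly (\<Prod>x\<leftarrow>xs. [:x, 1:]) \<mu> = (\<Sum>k=0..length xs. coeff (\<Prod>x\<leftarrow>xs. [:x, 1:]) k * \<mu> ^ k)"
    unfolding poly_altdef by (intro sum.mono_neutral_left) (auto simp: coeff_eq_0)
  finally show ?thesis by (simp add: coeff_prod_linear_factors)
qed

text \<open>By uniqueness of the mixed discriminants; \<open>coeff_mean\<close> also vanishes above
  \<open>CARD('n)\<close>, as \<open>is_mixed_discs\<close> demands.\<close>

lemma mixed_disc_eq_coeff_mean:
  fixes A :: "real^'n^'n"
  assumes "length xs = CARD('n)" and "\<And>\<mu>. det (A + \<mu> *\<^sub>R mat 1) = (\<Prod>x\<leftarrow>xs. x + \<mu>)"
  shows "mixed_disc k A = coeff_mean xs k"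
  by (rule mixed_disc_eq)
     (auto simp: is_mixed_discs_def assms prod_list_eq_sum_coeff_mean coeff_mean_eq_0)

lemma coeff_mean_replicate: "k \<le> m \<Longrightarrow> coeff_mean (replicate m c) k = c ^ (m - k)"
proof (induction m arbitrary: k)
  case (Suc m)
  show ?case
  proof (cases "k = Suc m")
    case True
    then show ?thesis using coeff_mean_length[of "replicate (Suc m) c"] by simp
  next
    case False
    with Suc.prems have k: "k \<le> m" by simp
    have "real k * c ^ (m - (k - 1)) = real k * c * c ^ (m - k)"
      using k by (cases k) (auto simp: Suc_diff_Suc simp flip: power_Suc)
    with k show ?thesis
      by (simp add: Suc.IH Suc_diff_le field_simps)
  qed
qed simp

lemma coeff_mean_scale:
  "k \<le> length xs \<Longrightarrow> coeff_mean (map ((*) c) xs) k = c ^ (length xs - k) * coeff_mean xs k"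
proof (induction xs arbitrary: k)
  case (Cons x xs)
  show ?case
  proof (cases "k = Suc (length xs)")
    case True
    then show ?thesis
      using coeff_mean_length[of "map ((*) c) (x # xs)"] coeff_mean_length[of "x # xs"] by simp
  next
    case False
    with Cons.prems have k: "k \<le> length xs" by simp
    have "real k * c ^ (length xs - (k - 1)) = real k * c * c ^ (length xs - k)"
      using k by (cases k) (auto simp: Suc_diff_Suc simp flip: power_Suc)
    then have 1: "real k * coeff_mean (map ((*) c) xs) (k - 1)
        = real k * c * c ^ (length xs - k) * coeff_mean xs (k - 1)"
      using k Cons.IH[of "k - 1"] by (cases k) auto
    show ?thesis
      unfolding list.map coeff_mean.simps length_map 1 Cons.IH[OF k]
      using k by (simp add: Suc_diff_le) (simp add: algebra_simps)
  qed
qed simp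

text \<open>Shifting the entries by \<open>s\<close> replaces \<mu> by \<mu> + \<open>s\<close>, so
  the derivative of coefficient \<open>k\<close> is \<open>k + 1\<close> times coefficient
  \<open>k + 1\<close>; dividing by the binomials leaves \<open>n - k\<close>.\<close>

lemma coeff_mean_shift_deriv:
  "((\<lambda>s. coeff_mean (map ((+) s) xs) k) has_real_derivative
     (real (length xs) - real k) * coeff_mean (map ((+) s) xs) (Suc k)) (at s)"
proof (induction xs arbitrary: k)
  case (Cons x xs)
  let ?D = "\<lambda>k. coeff_mean (map ((+) s) xs) k"
  let ?n = "real (Suc (length xs))"
  \<comment> \<open>The derivative in the shape that the product rule yields.
    \<open>Suc (k - 1)\<close> differs from \<open>k\<close> only at \<open>k = 0\<close>, where the
    factor \<open>real k\<close> removes it.\<close>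
  let ?f = "(((0 + 1) * ?D k + (s + x) * ((real (length xs) - real k) * ?D (Suc k))) * (?n - real k)
      + real k * ((real (length xs) - real (k - 1)) * ?D (Suc (k - 1)))) / ?n"
  have "((\<lambda>s. ((s + x) * coeff_mean (map ((+) s) xs) k * (?n - real k)
      + real k * coeff_mean (map ((+) s) xs) (k - 1)) / ?n) has_real_derivative ?f) (at s)"
    by (rule derivative_eq_intros Cons.IH refl | simp)+
  moreover have "?f = (?n - real k) * coeff_mean (map ((+) s) (x # xs)) (Suc k)"
    by (cases k) (simp_all add: divide_simps, simp_all add: algebra_simps)
  ultimately show ?case by (simp add: mult_ac)
qed simp

section \<open>Newton's inequality and its equality case\<close>

text \<open>Multiply the two log-concavity inequalities and cancel \<open>b * c > 0\<close>. This
  gives the sign of the last summand in \<open>newton_identity\<close>.\<close>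

lemma outer_prod_le_inner_prod:
  fixes a b c d :: real
  assumes "0 \<le> a" "0 < b" "0 < c" "0 \<le> d" "a * c \<le> b\<^sup>2" "b * d \<le> c\<^sup>2"
  shows "a * d \<le> b * c"
proof -
  have "(a * c) * (b * d) \<le> b\<^sup>2 * c\<^sup>2"
    using assms by (intro mult_mono) auto
  then have "(a * d) * (b * c) \<le> (b * c) * (b * c)"
    by (simp add: power2_eq_square algebra_simps)
  then show ?thesis using assms by (simp add: mult_le_cancel_right)
qed

text \<open>Here \<open>p\<close>, \<open>q\<close>, \<open>u\<close>, \<open>v\<close> stand for
  four consecutive coefficient means of the tail, and the three linear forms on the left for those
  of the list extended by \<open>x\<close>.\<close>

lemma newton_identity:
  fixes a b x p q u v :: real
  shows "(a * x * u + b * q)\<^sup>2 - ((a + 1) * x * q + (b - 1) * p) * ((a - 1) * x * v + (b + 1) * u)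
    = (x * u - q)\<^sup>2 + (a\<^sup>2 - 1) * x\<^sup>2 * (u\<^sup>2 - q * v) + (b\<^sup>2 - 1) * (q\<^sup>2 - p * u)
      + x * (a - 1) * (b - 1) * (q * u - p * v)"
  by algebra

text \<open>With \<open>a, b \<ge> 1\<close>, every summand on the right is nonnegative as soon as Newton's inequality
  holds for \<open>xs\<close>; this carries both the induction and its equality case.\<close>

lemma coeff_mean_Cons_newton:
  fixes xs k x
  defines "D \<equiv> coeff_mean xs" and "E \<equiv> coeff_mean (x # xs)"
    and "n \<equiv> real (Suc (length xs))"
  defines "a \<equiv> n - real k - 1" and "b \<equiv> real k + 1"
  shows "n\<^sup>2 * ((E (k + 1))\<^sup>2 - E k * E (k + 2)) =
    (x * D (k + 1) - D k)\<^sup>2 + (a\<^sup>2 - 1) * x\<^sup>2 * ((D (k + 1))\<^sup>2 - D k * D (k + 2))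
    + (b\<^sup>2 - 1) * ((D k)\<^sup>2 - D (k - 1) * D (k + 1))
    + x * (a - 1) * (b - 1) * (D k * D (k + 1) - D (k - 1) * D (k + 2))"
proof -
  have "n > 0" by (simp add: n_def)
  have "n * E k = (a + 1) * x * D k + (b - 1) * D (k - 1)"
    "n * E (k + 1) = a * x * D (k + 1) + b * D k"
    "n * E (k + 2) = (a - 1) * x * D (k + 2) + (b + 1) * D (k + 1)"
    by (simp_all add: D_def E_def n_def a_def b_def field_simps)
  then show ?thesis
    unfolding newton_identity[symmetric] by (simp flip: \<open>n * E k = _\<close> \<open>n * E (k + 1) = _\<close> \<open>n * E (k + 2) = _\<close>) algebra
qed

lemma newton_inequality:
  assumes "\<forall>x\<in>set xs. 0 < x"
  shows "coeff_mean xs k * coeff_mean xs (k + 2) \<le> (coeff_mean xs (k + 1))\<^sup>2"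
  using assms
proof (induction xs arbitrary: k)
  case (Cons x xs)
  let ?D = "coeff_mean xs" and ?E = "coeff_mean (x # xs)" and ?n = "real (Suc (length xs))"
  let ?a = "?n - real k - 1" and ?b = "real k + 1"
  have pos: "\<forall>x\<in>set xs. 0 < x" "0 < x" using Cons.prems by auto
  show ?case
  proof (cases "k + 2 \<le> Suc (length xs)")
    case True
    then have a: "1 \<le> ?a" and b: "1 \<le> ?b" by auto
    have 1: "0 \<le> (?D (k + 1))\<^sup>2 - ?D k * ?D (k + 2)" using Cons by simp
    have 2: "0 \<le> (?b\<^sup>2 - 1) * ((?D k)\<^sup>2 - ?D (k - 1) * ?D (k + 1))"
    proof (cases k)
      case (Suc j)
      then show ?thesis using Cons.IH[OF pos(1), of j] by (intro mult_nonneg_nonneg) auto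
    qed simp
    have 3: "0 \<le> x * (?a - 1) * (?b - 1) * (?D k * ?D (k + 1) - ?D (k - 1) * ?D (k + 2))"
    proof (cases k)
      case (Suc j)
      \<comment> \<open>The middle terms are positive because \<open>k + 1 \<le> length xs\<close>;
        \<open>?D (k + 2)\<close> may be zero.\<close>
      have "?D (k - 1) * ?D (k + 2) \<le> ?D k * ?D (k + 1)"
        using Cons.IH[OF pos(1), of j] Cons.IH[OF pos(1), of k] Suc True pos
        by (intro outer_prod_le_inner_prod) (auto intro: coeff_mean_pos coeff_mean_nonneg)
      then show ?thesis using a b pos by (intro mult_nonneg_nonneg) auto
    qed simp
    have 4: "0 \<le> (?a\<^sup>2 - 1) * x\<^sup>2 * ((?D (k + 1))\<^sup>2 - ?D k * ?D (k + 2))"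
      using a 1 by (intro mult_nonneg_nonneg) (auto simp: one_le_power)
    have "0 \<le> ?n\<^sup>2 * ((?E (k + 1))\<^sup>2 - ?E k * ?E (k + 2))"
      unfolding coeff_mean_Cons_newton using 2 3 4 by (intro add_nonneg_nonneg) auto
    then show ?thesis by (simp add: zero_le_mult_iff del: coeff_mean.simps of_nat_Suc)
  next
    case False
    then show ?thesis by (simp add: coeff_mean_eq_0 del: coeff_mean.simps)
  qed
qed auto

text \<open>Equality forces all four summands to vanish. The second or third passes equality on to
  \<open>xs\<close>, making it constant, and the square then forces \<open>x\<close> to be the same
  constant. The bound on \<open>k\<close> rules out \<open>k \<ge> length xs\<close>, where both
  sides vanish for any list.\<close>

lemma newton_equality:
  assumes "\<forall>x\<in>set xs. 0 < x" "k + 2 \<le> length xs"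
    and "coeff_mean xs k * coeff_mean xs (k + 2) = (coeff_mean xs (k + 1))\<^sup>2"
  shows "\<exists>c. xs = replicate (length xs) c"
  using assms
proof (induction xs arbitrary: k)
  case (Cons x xs)
  let ?D = "coeff_mean xs" and ?E = "coeff_mean (x # xs)" and ?n = "real (Suc (length xs))"
  let ?a = "?n - real k - 1" and ?b = "real k + 1"
  have pos: "\<forall>x\<in>set xs. 0 < x" "0 < x" using Cons.prems by auto
  have a: "1 \<le> ?a" and b: "1 \<le> ?b" using Cons.prems(2) by auto
  have newton: "0 \<le> (?D (j + 1))\<^sup>2 - ?D j * ?D (j + 2)" for j
    using newton_inequality[OF pos(1)] by simp
  define T1 where "T1 = (x * ?D (k + 1) - ?D k)\<^sup>2"
  define T2 where "T2 = (?a\<^sup>2 - 1) * x\<^sup>2 * ((?D (k + 1))\<^sup>2 - ?D k * ?D (k + 2))"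
  define T3 where "T3 = (?b\<^sup>2 - 1) * ((?D k)\<^sup>2 - ?D (k - 1) * ?D (k + 1))"
  define T4 where "T4 = x * (?a - 1) * (?b - 1) * (?D k * ?D (k + 1) - ?D (k - 1) * ?D (k + 2))"
  have "T1 + T2 + T3 + T4 = ?n\<^sup>2 * ((?E (k + 1))\<^sup>2 - ?E k * ?E (k + 2))"
    unfolding coeff_mean_Cons_newton T1_def T2_def T3_def T4_def ..
  also have "\<dots> = 0" using Cons.prems(3) by simp
  finally have sum0: "T1 + T2 + T3 + T4 = 0" .
  have T1: "0 \<le> T1" by (simp add: T1_def)
  have T2: "0 \<le> T2"
    unfolding T2_def using a newton[of k] by (intro mult_nonneg_nonneg) (auto simp: one_le_power)
  have T3: "0 \<le> T3"
  proof (cases k)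
    case (Suc j)
    then show ?thesis unfolding T3_def using newton[of j] by (intro mult_nonneg_nonneg) auto
  qed (simp add: T3_def)
  have T4: "0 \<le> T4"
  proof (cases k)
    case (Suc j)
    have "?D (k - 1) * ?D (k + 2) \<le> ?D k * ?D (k + 1)"
      using newton[of j] newton[of k] Suc Cons.prems(2) pos
      by (intro outer_prod_le_inner_prod) (auto intro: coeff_mean_pos coeff_mean_nonneg)
    then show ?thesis unfolding T4_def using a b pos by (intro mult_nonneg_nonneg) auto
  qed (simp add: T4_def)
  have zero: "T1 = 0" "T2 = 0" "T3 = 0" using sum0 T1 T2 T3 T4 by auto
  have "\<exists>c. xs = replicate (length xs) c"
  \<comment> \<open>If \<open>length xs = k + 1\<close>, then \<open>?a = 1\<close> and
    \<open>T2\<close> says nothing, so \<open>T3\<close> supplies equality one index lower; for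
    \<open>k = 0\<close> the tail is a single entry.\<close>
  proof (cases "k + 2 \<le> length xs")
    case True
    then have "1 < ?a" by simp
    then have "1 < ?a\<^sup>2" by (simp add: one_less_power)
    then have "?D k * ?D (k + 2) = (?D (k + 1))\<^sup>2"
      using zero(2) pos(2) by (simp add: T2_def)
    then show ?thesis using Cons.IH[OF pos(1) True] by blast
  next
    case False
    with Cons.prems(2) have len: "length xs = Suc k" by simp
    show ?thesis
    proof (cases k)
      case 0
      with len obtain y where "xs = [y]" by (auto simp: length_Suc_conv)
      then show ?thesis by (intro exI[of _ y]) simp
    next
      case (Suc j)
      have "?b\<^sup>2 - 1 = real k * (real k + 2)" by algebra
      with Suc have "?b\<^sup>2 - 1 \<noteq> 0" by simp
      then have "?D j * ?D (j + 2) = (?D (j + 1))\<^sup>2"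
        using zero(3) unfolding T3_def mult_eq_0_iff by (simp add: Suc)
      then show ?thesis using Cons.IH[OF pos(1), of j] Suc len by auto
    qed
  qed
  then obtain c where c: "xs = replicate (length xs) c" ..
  have "?D k = x * ?D (k + 1)" using zero(1) by (simp add: T1_def)
  moreover have "?D k = c ^ (length xs - k)" "?D (k + 1) = c ^ (length xs - (k + 1))"
    using Cons.prems(2) by (subst c, simp add: coeff_mean_replicate)+
  moreover have "c ^ (length xs - k) = c * c ^ (length xs - (k + 1))"
    using Cons.prems(2) by (simp flip: power_Suc add: Suc_diff_Suc)
  moreover have "0 < c"
    using pos(1) Cons.prems(2) by (subst (asm) c) auto
  ultimately have "x = c" by simp
  then show ?case using c by (metis length_Cons replicate_Suc)
qed simp

section \<open>Growth of coefficient ratios under a shift\<close>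

text \<open>Subtracting \<open>s\<close> removes one copy of \<open>(D (i + 1))\<^sup>2\<close> from
  the numerator of the quotient rule, which leaves a multiple of the defect in Newton's
  inequality.\<close>

lemma coeff_mean_ratio_deriv:
  fixes xs i s
  defines "D \<equiv> coeff_mean (map ((+) s) xs)"
  assumes pos: "\<forall>x\<in>set xs. 0 < x" and i: "i < length xs" and s: "0 \<le> s"
  shows "((\<lambda>s. coeff_mean (map ((+) s) xs) i / coeff_mean (map ((+) s) xs) (i + 1) - s)
    has_real_derivative (real (length xs) - real i - 1) * ((D (i + 1))\<^sup>2 - D i * D (i + 2))
      / (D (i + 1))\<^sup>2) (at s)"
proof -
  have "0 < D (i + 1)"
    unfolding D_def using assms by (intro coeff_mean_pos) auto
  moreover have "((a1 * D (i + 1) - D i * a2) / (D (i + 1) * D (i + 1)) - 1)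
      = (real (length xs) - real i - 1) * ((D (i + 1))\<^sup>2 - D i * D (i + 2)) / (D (i + 1))\<^sup>2"
    if "a1 = (real (length xs) - real i) * D (Suc i)"
      "a2 = (real (length xs) - real (i + 1)) * D (Suc (i + 1))" for a1 a2
    unfolding that using \<open>0 < D (i + 1)\<close>
    by (simp add: divide_simps power2_eq_square) (simp add: algebra_simps)
  ultimately show ?thesis
    unfolding D_def
    by (intro DERIV_cong[OF DERIV_diff[OF DERIV_divide[OF coeff_mean_shift_deriv
          coeff_mean_shift_deriv] DERIV_ident]]) auto
qed

lemma coeff_mean_ratio_shift:
  assumes pos: "\<forall>x\<in>set xs. 0 < x" and i: "i < length xs" and s: "0 \<le> s"
  shows "coeff_mean xs i / coeff_mean xs (i + 1) + s
    \<le> coeff_mean (map ((+) s) xs) i / coeff_mean (map ((+) s) xs) (i + 1)"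
proof -
  let ?D = "\<lambda>u. coeff_mean (map ((+) u) xs)"
  have "\<exists>y. ((\<lambda>s. ?D s i / ?D s (i + 1) - s) has_real_derivative y) (at u) \<and> 0 \<le> y"
    if "0 \<le> u" for u
  proof (intro exI conjI)
    show "0 \<le> (real (length xs) - real i - 1)
        * ((?D u (i + 1))\<^sup>2 - ?D u i * ?D u (i + 2)) / (?D u (i + 1))\<^sup>2"
      using i that pos newton_inequality[of "map ((+) u) xs" i]
      by (intro divide_nonneg_nonneg mult_nonneg_nonneg) (auto intro: add_nonneg_pos)
  qed (use coeff_mean_ratio_deriv pos i that in blast)
  from DERIV_nonneg_imp_nondecreasing[OF s this] show ?thesis
    by (simp add: map_idI)
qed

lemma coeff_mean_ratio_shift_strict:
  assumes pos: "\<forall>x\<in>set xs. 0 < x" and i: "i + 2 \<le> length xs" and s: "0 < s"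
    and neq: "\<nexists>c. xs = replicate (length xs) c"
  shows "coeff_mean xs i / coeff_mean xs (i + 1) + s
    < coeff_mean (map ((+) s) xs) i / coeff_mean (map ((+) s) xs) (i + 1)"
proof -
  let ?D = "\<lambda>u. coeff_mean (map ((+) u) xs)"
  have "\<exists>y. ((\<lambda>s. ?D s i / ?D s (i + 1) - s) has_real_derivative y) (at u) \<and> 0 < y"
    if "0 \<le> u" for u
  proof (intro exI conjI)
    have pos': "\<forall>x\<in>set (map ((+) u) xs). 0 < x"
      using pos that by (auto intro: add_nonneg_pos)
    have "?D u i * ?D u (i + 2) \<noteq> (?D u (i + 1))\<^sup>2"
    proof
      assume "?D u i * ?D u (i + 2) = (?D u (i + 1))\<^sup>2"
      then obtain c where "map ((+) u) xs = replicate (length xs) c"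
        using newton_equality[OF pos', of i] i by auto
      \<comment> \<open>Undoing the shift shows that a non-constant list stays non-constant.\<close>
      then have "map (\<lambda>x. x - u) (map ((+) u) xs) = replicate (length xs) (c - u)"
        by simp
      then show False using neq by (simp add: o_def)
    qed
    then have "?D u i * ?D u (i + 2) < (?D u (i + 1))\<^sup>2"
      using newton_inequality[OF pos', of i] by simp
    moreover have "0 < ?D u (i + 1)" using pos' i by (intro coeff_mean_pos) auto
    ultimately show "0 < (real (length xs) - real i - 1)
        * ((?D u (i + 1))\<^sup>2 - ?D u i * ?D u (i + 2)) / (?D u (i + 1))\<^sup>2"
      using i by (intro divide_pos_pos mult_pos_pos) auto
  qed (use coeff_mean_ratio_deriv[of xs i u] pos i that in simp)
  from DERIV_pos_imp_increasing[OF s this] show ?thesis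
    by (simp add: map_idI)
qed

section \<open>The characteristic polynomial of a symmetric matrix\<close>

text \<open>The coefficient is taken at \<open>card S\<close> rather than at the degree, since some
  factors may be constant.\<close>

lemma degree_coeff_prod_linear:
  fixes f :: "'b \<Rightarrow> 'a::comm_ring_1 poly"
  assumes "finite S" "\<And>i. i \<in> S \<Longrightarrow> degree (f i) \<le> 1"
  shows "degree (\<Prod>i\<in>S. f i) \<le> card S \<and> coeff (\<Prod>i\<in>S. f i) (card S) = (\<Prod>i\<in>S. coeff (f i) 1)"
  using assms
proof (induction S)
  case (insert i S)
  let ?q = "\<Prod>i\<in>S. f i"
  obtain a r where r: "f i = pCons a r" by (rule pCons_cases)
  then have "degree r = 0" using insert.prems[of i] by (cases "r = 0") auto
  then obtain b where f: "f i = [:a, b:]" using r by (metis degree_eq_zeroE)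
  have "degree (f i * ?q) \<le> 1 + card S"
    using degree_mult_le[of "f i" ?q] insert by (meson add_mono insertCI order_trans)
  moreover have "coeff ?q (Suc (card S)) = 0"
    using insert by (intro coeff_eq_0) (auto simp: less_Suc_eq_le)
  ultimately show ?case using insert f by simp
qed auto

text \<open>The sign is opposite to the usual characteristic matrix, so the roots of the determinant
  are the negated eigenvalues. The ring is general because the roots are sought over the complex
  numbers.\<close>

definition char_mat :: "'a::comm_ring_1^'n^'n \<Rightarrow> 'a poly^'n^'n" where
  "char_mat A = (\<chi> i j. [:A$i$j, if i = j then 1 else 0:])"

lemma poly_det_char_mat: "poly (det (char_mat A)) z = det (A + (\<chi> i j. if i = j then z else 0))"
  unfolding det_def
  by (auto simp: poly_sum poly_prod char_mat_def intro!: sum.cong prod.cong arg_cong2[of _ _ _ _ "(*)"])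

lemma
  fixes A :: "'a::idom^'n^'n"
  shows degree_det_char_mat: "degree (det (char_mat A)) = CARD('n)"
    and lead_coeff_det_char_mat: "lead_coeff (det (char_mat A)) = 1"
proof -
  \<comment> \<open>In each Leibniz term the coefficient at \<open>CARD('n)\<close> is the matching
    product for the identity matrix, so for the determinant it is
    \<open>det (mat 1) = 1\<close>.\<close>
  have *: "degree (\<Prod>i\<in>UNIV. char_mat A $ i $ p i) \<le> CARD('n) \<and>
      coeff (\<Prod>i\<in>UNIV. char_mat A $ i $ p i) CARD('n) = (\<Prod>i\<in>UNIV. (mat 1 :: 'a^'n^'n) $ i $ p i)"
    for p :: "'n \<Rightarrow> 'n"
    using degree_coeff_prod_linear[of UNIV "\<lambda>i. char_mat A $ i $ p i"]
    by (simp add: char_mat_def mat_def)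
  have deg: "degree (det (char_mat A)) \<le> CARD('n)"
    unfolding det_def
  proof (rule degree_sum_le)
    fix p :: "'n \<Rightarrow> 'n"
    show "degree (of_int (sign p) * (\<Prod>i\<in>UNIV. char_mat A $ i $ p i)) \<le> CARD('n)"
      using degree_mult_le[of "of_int (sign p)" "\<Prod>i\<in>UNIV. char_mat A $ i $ p i"] *[of p]
      by simp
  qed (simp add: finite_permutations)
  have "coeff (of_int m * q) k = of_int m * coeff q k" for m k and q :: "'a poly"
    by (simp add: of_int_poly)
  then have "coeff (det (char_mat A)) CARD('n) = det (mat 1 :: 'a^'n^'n)"
    unfolding det_def by (simp add: coeff_sum *)
  then have "coeff (det (char_mat A)) CARD('n) = 1" by simp
  with deg show "degree (det (char_mat A)) = CARD('n)"
    by (metis le_antisym le_degree zero_neq_one)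
  with \<open>coeff (det (char_mat A)) CARD('n) = 1\<close> show "lead_coeff (det (char_mat A)) = 1" by simp
qed

lemma symmetric_inner:
  fixes A :: "real^'n^'n"
  assumes "transpose A = A"
  shows "x \<bullet> (A *v y) = (A *v x) \<bullet> y"
  using assms by (metis dot_lmul_matrix vector_transpose_matrix)

text \<open>Split a null vector into real and imaginary parts \<open>x\<close>, \<open>y\<close>.
  Symmetry, applied to \<open>x\<close> and \<open>y\<close>, kills \<open>Im z\<close>; whichever
  of them is nonzero is then a real eigenvector for \<open>- Re z\<close>, which is positive by
  definiteness.\<close>

lemma complex_eigenvalue_symmetric_posdef:
  fixes A :: "real^'n^'n" and z :: complex
  assumes sym: "transpose A = A" and pd: "positive_definite A"
    and det: "det ((\<chi> i j. complex_of_real (A$i$j)) + (\<chi> i j. if i = j then z else 0)) = 0"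
  shows "Im z = 0" "Re z < 0"
proof -
  let ?C = "(\<chi> i j. complex_of_real (A$i$j)) + (\<chi> i j. if i = j then z else 0) :: complex^'n^'n"
  obtain v where v: "?C *v v = 0" "v \<noteq> 0"
    using det by (metis invertible_det_nz invertible_left_inverse matrix_left_invertible_ker)
  define x y :: "real^'n" where "x = (\<chi> i. Re (v$i))" and "y = (\<chi> i. Im (v$i))"
  have comp: "(\<Sum>j\<in>UNIV. complex_of_real (A$i$j) * v$j) + z * v$i = 0" for i
  proof -
    have "(?C *v v) $ i = (\<Sum>j\<in>UNIV. complex_of_real (A$i$j) * v$j) + (\<Sum>j\<in>UNIV. (if i = j then z else 0) * v$j)"
      by (simp add: matrix_vector_mult_def distrib_right sum.distrib)
    also have "(\<Sum>j\<in>UNIV. (if i = j then z else 0) * v$j) = z * v$i"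
      by (subst sum.remove[of _ i]) auto
    finally show ?thesis using v(1) by simp
  qed
  have Ax: "A *v x = Im z *\<^sub>R y - Re z *\<^sub>R x"
    using arg_cong[OF comp, of Re]
    by (simp add: vec_eq_iff matrix_vector_mult_def x_def y_def eq_diff_eq algebra_simps)
  have Ay: "A *v y = - (Im z *\<^sub>R x + Re z *\<^sub>R y)"
    using arg_cong[OF comp, of Im]
    by (simp add: vec_eq_iff matrix_vector_mult_def x_def y_def eq_neg_iff_add_eq_0 algebra_simps)
  have nz: "x \<noteq> 0 \<or> y \<noteq> 0"
    using v(2) by (auto simp: vec_eq_iff x_def y_def complex_eq_iff)
  have "Im z * (x \<bullet> x + y \<bullet> y) = 0"
    using symmetric_inner[OF sym, of x y] unfolding Ax Ay
    by (simp add: inner_simps inner_commute algebra_simps)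
  moreover have "x \<bullet> x + y \<bullet> y \<noteq> 0"
    using nz by (auto simp: add_nonneg_eq_0_iff)
  ultimately show im: "Im z = 0" by simp
  have "Re z < 0" if "A *v u = - (Re z *\<^sub>R u)" "u \<noteq> 0" for u
  proof -
    have "0 < u \<bullet> (A *v u)" using pd that by (auto simp: positive_definite_def)
    then have "Re z * (u \<bullet> u) < 0" using that by simp
    moreover have "0 < u \<bullet> u" using that by simp
    ultimately show ?thesis by (simp add: mult_less_0_iff)
  qed
  with nz Ax Ay im show "Re z < 0" by auto
qed

text \<open>The polynomial splits over the complex numbers, and its roots are real and negative;
  \<open>xs\<close> lists their negatives with multiplicity.\<close>

lemma symmetric_posdef_det_factors:
  fixes A :: "real^'n^'n"
  assumes sym: "transpose A = A" and pd: "positive_definite A"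
  obtains xs where "length xs = CARD('n)" "\<forall>x\<in>set xs. 0 < x"
    "\<And>\<mu>. det (A + \<mu> *\<^sub>R mat 1) = (\<Prod>x\<leftarrow>xs. x + \<mu>)"
proof -
  define C :: "complex^'n^'n" where "C = (\<chi> i j. complex_of_real (A$i$j))"
  define p where "p = det (char_mat C)"
  have "degree p = CARD('n)" "lead_coeff p = 1"
    unfolding p_def by (rule degree_det_char_mat lead_coeff_det_char_mat)+
  moreover obtain root where "smult (lead_coeff p) (\<Prod>i<degree p. [:-root i, 1:]) = p"
    by (rule complex_poly_decompose')
  ultimately have p: "p = (\<Prod>i<CARD('n). [:-root i, 1:])"
    by (metis smult_1_left)
  have root: "Im (root i) = 0 \<and> Re (root i) < 0" if "i < CARD('n)" for i
  proof -
    have "poly p (root i) = 0" unfolding p poly_prod using that by (intro prod_zero) auto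
    then show ?thesis
      using complex_eigenvalue_symmetric_posdef[OF sym pd, of "root i"]
      by (simp add: p_def poly_det_char_mat C_def)
  qed
  define xs where "xs = map (\<lambda>i. - Re (root i)) [0..<CARD('n)]"
  have "det (A + \<mu> *\<^sub>R mat 1) = (\<Prod>x\<leftarrow>xs. x + \<mu>)" for \<mu>
  proof -
    have "complex_of_real (det (A + \<mu> *\<^sub>R mat 1)) = poly p (of_real \<mu>)"
      unfolding p_def poly_det_char_mat unfolding det_def
      by (auto simp: C_def mat_def intro!: sum.cong prod.cong arg_cong2[of _ _ _ _ "(*)"])
    also have "\<dots> = (\<Prod>i<CARD('n). of_real (- Re (root i) + \<mu>))"
      unfolding p poly_prod using root by (intro prod.cong) (auto simp: complex_eq_iff)
    also have "\<dots> = of_real (\<Prod>x\<leftarrow>xs. x + \<mu>)"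
      unfolding of_real_prod[symmetric]
      using prod.distinct_set_conv_list[of "[0..<CARD('n)]" "\<lambda>i. - Re (root i) + \<mu>"]
      by (simp add: xs_def o_def atLeast0LessThan)
    finally show ?thesis using of_real_eq_iff by blast
  qed
  with root show ?thesis by (intro that[of xs]) (auto simp: xs_def)
qed

section \<open>Extreme values of the quadratic form and scalar matrices\<close>

lemma psd_null_vector:
  fixes C :: "real^'n^'n"
  assumes sym: "transpose C = C" and psd: "\<And>x. 0 \<le> x \<bullet> (C *v x)" and v: "v \<bullet> (C *v v) = 0"
  shows "C *v v = 0"
proof (rule ccontr)
  let ?w = "C *v v"
  assume "?w \<noteq> 0"
  then have w: "0 < ?w \<bullet> ?w" by simp
  define q where "q = ?w \<bullet> (C *v ?w)"
  have q: "0 \<le> q" using psd by (simp add: q_def)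
  \<comment> \<open>A negative step short enough that the linear term outweighs the quadratic one;
    the \<open>1 +\<close> keeps the denominator positive when \<open>q = 0\<close>.\<close>
  define t where "t = - (?w \<bullet> ?w) / (1 + q)"
  have "(v + t *\<^sub>R ?w) \<bullet> (C *v (v + t *\<^sub>R ?w)) = t * (2 * (?w \<bullet> ?w) + t * q)"
    using v symmetric_inner[OF sym, of v ?w]
    by (simp add: matrix_vector_right_distrib matrix_vector_mult_scaleR inner_simps q_def algebra_simps)
  also have "2 * (?w \<bullet> ?w) + t * q = (?w \<bullet> ?w) * (2 + q) / (1 + q)"
    using q by (simp add: t_def field_simps)
  also have "t * \<dots> < 0"
    using w q by (auto simp: t_def intro!: mult_neg_pos divide_neg_pos divide_pos_pos)
  finally show False using psd[of "v + t *\<^sub>R ?w"] by simp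
qed

text \<open>The form attains its maximum \<open>m\<close> on the unit sphere at some
  \<open>v\<close>. Then \<open>m *\<^sub>R mat 1 - B\<close> is positive semidefinite with its form
  zero at \<open>v\<close>, so \<open>v\<close> is an eigenvector.\<close>

lemma symmetric_eigenvalue_max:
  fixes B :: "real^'n^'n"
  assumes sym: "transpose B = B"
  obtains m where "det (B - m *\<^sub>R mat 1) = 0" "\<And>x. x \<bullet> (B *v x) \<le> m * (x \<bullet> x)"
proof -
  have "continuous_on (sphere 0 1) (\<lambda>x. x \<bullet> (B *v x))"
    by (intro continuous_intros matrix_vector_mult_linear_continuous_on)
  moreover have "sphere (0::real^'n) 1 \<noteq> {}"
    using norm_axis_1 by (metis emptyE mem_sphere_0)
  ultimately obtain v where v: "v \<in> sphere 0 1" "\<And>x. x \<in> sphere 0 1 \<Longrightarrow> x \<bullet> (B *v x) \<le> v \<bullet> (B *v v)"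
    using continuous_attains_sup[OF compact_sphere] by blast
  define m where "m = v \<bullet> (B *v v)"
  have max: "x \<bullet> (B *v x) \<le> m * (x \<bullet> x)" for x
  proof (cases "x = 0")
    case False
    have "(inverse (norm x) *\<^sub>R x) \<bullet> (B *v (inverse (norm x) *\<^sub>R x)) \<le> m"
      unfolding m_def using False by (intro v) simp
    then have "(x \<bullet> (B *v x)) / (norm x * norm x) \<le> m"
      by (simp add: matrix_vector_mult_scaleR field_simps)
    then show ?thesis using False
      by (simp add: divide_le_eq power2_eq_square flip: power2_norm_eq_inner)
  qed simp
  define C where "C = m *\<^sub>R mat 1 - B"
  have C: "C *v x = m *\<^sub>R x - B *v x" for x
    by (simp add: C_def matrix_vector_mult_diff_rdistrib flip: scaleR_matrix_vector_assoc)
  have "transpose C = C"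
    using sym by (simp add: C_def transpose_def vec_eq_iff mat_def)
  moreover have "0 \<le> x \<bullet> (C *v x)" for x
    using max[of x] by (simp add: C inner_simps)
  moreover have "v \<bullet> (C *v v) = 0"
    using v(1) by (simp add: C inner_simps m_def norm_eq_1)
  ultimately have "C *v v = 0" by (rule psd_null_vector)
  then have "(B - m *\<^sub>R mat 1) *v v = 0"
    by (simp add: C matrix_vector_mult_diff_rdistrib flip: scaleR_matrix_vector_assoc)
  moreover have "v \<noteq> 0" using v(1) by auto
  ultimately have "det (B - m *\<^sub>R mat 1) = 0"
    by (metis invertible_det_nz invertible_left_inverse matrix_left_invertible_ker)
  then show ?thesis using max by (rule that)
qed

lemma symmetric_quadratic_form_zero:
  fixes B :: "real^'n^'n"
  assumes "transpose B = B" and "\<And>x. x \<bullet> (B *v x) = 0"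
  shows "B = 0"
  using psd_null_vector[of B] assms by (simp add: matrix_eq)

lemma det_scaleR:
  fixes A :: "real^'n^'n"
  shows "det (c *\<^sub>R A) = c ^ CARD('n) * det A"
  by (simp add: det_def prod.distrib sum_distrib_left mult_ac)

text \<open>The maximum of the form is an eigenvalue, hence \<open>c\<close>. Applying this to
  \<open>- A\<close> gives the minimum, so the form of \<open>A - c *\<^sub>R mat 1\<close>
  vanishes.\<close>

lemma symmetric_det_power_imp_scalar:
  fixes A :: "real^'n^'n"
  assumes sym: "transpose A = A" and det: "\<And>\<mu>. det (A + \<mu> *\<^sub>R mat 1) = (c + \<mu>) ^ CARD('n)"
  shows "A = c *\<^sub>R mat 1"
proof -
  have upper: "x \<bullet> (A *v x) \<le> c * (x \<bullet> x)" for x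
  proof -
    obtain m where m: "det (A - m *\<^sub>R mat 1) = 0" "\<And>x. x \<bullet> (A *v x) \<le> m * (x \<bullet> x)"
      using symmetric_eigenvalue_max[OF sym] by blast
    then have "m = c" using det[of "- m"] by simp
    with m show ?thesis by simp
  qed
  have lower: "c * (x \<bullet> x) \<le> x \<bullet> (A *v x)" for x
  proof -
    have neg: "(- A) *v x = - (A *v x)" for x
      by (simp add: matrix_vector_mult_def vec_eq_iff sum_negf)
    have "transpose (- A) = - A"
      using sym by (simp add: transpose_def vec_eq_iff)
    then obtain m where m: "det (- A - m *\<^sub>R mat 1) = 0" "\<And>x. x \<bullet> ((- A) *v x) \<le> m * (x \<bullet> x)"
      using symmetric_eigenvalue_max by blast
    have "det (- A - m *\<^sub>R mat 1) = (- 1) ^ CARD('n) * det (A + m *\<^sub>R mat 1)"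
      using det_scaleR[of "-1" "A + m *\<^sub>R mat 1"] by (simp add: algebra_simps)
    then have "m = - c" using det[of m] m by simp
    with m(2)[of x] show ?thesis by (simp add: neg)
  qed
  define B where "B = A - c *\<^sub>R mat 1"
  have "transpose B = B"
    using sym by (simp add: B_def transpose_def vec_eq_iff mat_def)
  moreover have "x \<bullet> (B *v x) = 0" for x
    using upper[of x] lower[of x]
    by (simp add: B_def matrix_vector_mult_diff_rdistrib inner_simps flip: scaleR_matrix_vector_assoc)
  ultimately have "B = 0" by (rule symmetric_quadratic_form_zero)
  then show ?thesis by (simp add: B_def)
qed

section \<open>Ratios of mixed discriminants\<close>

lemma prod_list_scale:
  "c ^ length xs * (\<Prod>x\<leftarrow>xs. x + y) = (\<Prod>x\<leftarrow>xs. c * x + c * (y::real))"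
  by (induction xs) (auto simp: algebra_simps)

lemma mixed_disc_affine:
  fixes A :: "real^'n^'n"
  assumes len: "length xs = CARD('n)" and det: "\<And>\<mu>. det (A + \<mu> *\<^sub>R mat 1) = (\<Prod>x\<leftarrow>xs. x + \<mu>)"
    and c: "c \<noteq> 0"
  shows "mixed_disc k (c *\<^sub>R A + d *\<^sub>R mat 1) = coeff_mean (map (\<lambda>x. c * x + d) xs) k"
proof (rule mixed_disc_eq_coeff_mean)
  fix \<mu>
  have "c *\<^sub>R A + d *\<^sub>R mat 1 + \<mu> *\<^sub>R mat 1 = c *\<^sub>R (A + ((d + \<mu>) / c) *\<^sub>R mat 1)"
    using c by (simp add: algebra_simps add_divide_distrib)
  then show "det (c *\<^sub>R A + d *\<^sub>R mat 1 + \<mu> *\<^sub>R mat 1) = (\<Prod>x\<leftarrow>map (\<lambda>x. c * x + d) xs. x + \<mu>)"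
    using c by (simp add: det_scaleR det len[symmetric] prod_list_scale o_def add_ac)
qed (simp add: len)

lemma mixed_disc_scalar:
  assumes "k \<le> CARD('n)"
  shows "mixed_disc k (r *\<^sub>R mat 1 :: real^'n^'n) = r ^ (CARD('n) - k)"
proof -
  have "mixed_disc k (r *\<^sub>R mat 1 :: real^'n^'n) = coeff_mean (replicate CARD('n) r) k"
    by (rule mixed_disc_eq_coeff_mean)
       (simp_all add: map_replicate prod_list_replicate det_scaleR flip: scaleR_add_left)
  with assms show ?thesis by (simp add: coeff_mean_replicate)
qed

lemma mixed_disc_ratio_scalar:
  assumes "i < CARD('n)" "r \<noteq> 0"
  shows "mixed_disc i (r *\<^sub>R mat 1 :: real^'n^'n) / mixed_disc (i + 1) (r *\<^sub>R mat 1 :: real^'n^'n) = r"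
proof -
  have "r ^ (CARD('n) - i) = r * r ^ (CARD('n) - (i + 1))"
    using assms(1) by (simp flip: power_Suc add: Suc_diff_Suc)
  with assms show ?thesis by (simp add: mixed_disc_scalar)
qed

text \<open>Write \<open>c * x + d\<close> as \<open>c * (x + d / c)\<close>. Numerator and
  denominator are homogeneous of degrees \<open>n - i\<close> and \<open>n - i - 1\<close>, where
  \<open>n = CARD('n)\<close>, so one factor \<open>c\<close> survives.\<close>

lemma mixed_disc_ratio_affine:
  fixes A :: "real^'n^'n"
  assumes "length xs = CARD('n)" "\<And>\<mu>. det (A + \<mu> *\<^sub>R mat 1) = (\<Prod>x\<leftarrow>xs. x + \<mu>)"
    and i: "i < CARD('n)" and c: "0 < c"
  shows "mixed_disc i (c *\<^sub>R A + d *\<^sub>R mat 1) / mixed_disc (i + 1) (c *\<^sub>R A + d *\<^sub>R mat 1)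
    = c * (coeff_mean (map ((+) (d / c)) xs) i / coeff_mean (map ((+) (d / c)) xs) (i + 1))"
proof -
  have "mixed_disc k (c *\<^sub>R A + d *\<^sub>R mat 1)
      = c ^ (CARD('n) - k) * coeff_mean (map ((+) (d / c)) xs) k" if "k \<le> CARD('n)" for k
  proof -
    have "map (\<lambda>x. c * x + d) xs = map ((*) c) (map ((+) (d / c)) xs)"
      using c by (simp add: field_simps)
    then have "mixed_disc k (c *\<^sub>R A + d *\<^sub>R mat 1)
        = coeff_mean (map ((*) c) (map ((+) (d / c)) xs)) k"
      using mixed_disc_affine[OF assms(1,2), of c k d] c by (simp only: less_irrefl)
    then show ?thesis
      using that assms(1) by (subst (asm) coeff_mean_scale) auto
  qed
  moreover have "c ^ (CARD('n) - i) = c * c ^ (CARD('n) - (i + 1))"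
    using i by (simp flip: power_Suc add: Suc_diff_Suc)
  ultimately show ?thesis using i c by simp
qed

theorem theorem5p3:
  fixes A :: "real^'n^'n" and i :: nat and r :: real
  assumes "transpose A = A" and "positive_definite A"
    and "i \<le> CARD('n) - 1" and "0 < r"
  shows "(\<forall>t\<in>{0<..<1::real}.
            mixed_disc i ((1 - t) *\<^sub>R A + t *\<^sub>R (r *\<^sub>R mat 1))
              / mixed_disc (i + 1) ((1 - t) *\<^sub>R A + t *\<^sub>R (r *\<^sub>R mat 1))
            \<ge> (1 - t) * (mixed_disc i A / mixed_disc (i + 1) A)
              + t * (mixed_disc i (r *\<^sub>R mat 1 :: real^'n^'n)
                       / mixed_disc (i + 1) (r *\<^sub>R mat 1 :: real^'n^'n)))
       \<and> (i < CARD('n) - 1 \<longrightarrow>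
            ((\<exists>t\<in>{0<..<1::real}.
                mixed_disc i ((1 - t) *\<^sub>R A + t *\<^sub>R (r *\<^sub>R mat 1))
                  / mixed_disc (i + 1) ((1 - t) *\<^sub>R A + t *\<^sub>R (r *\<^sub>R mat 1))
                = (1 - t) * (mixed_disc i A / mixed_disc (i + 1) A)
                  + t * (mixed_disc i (r *\<^sub>R mat 1 :: real^'n^'n)
                           / mixed_disc (i + 1) (r *\<^sub>R mat 1 :: real^'n^'n)))
             \<longleftrightarrow> (\<exists>\<alpha>>0. A = \<alpha> *\<^sub>R mat 1)))"
proof -
  let ?R = "\<lambda>B :: real^'n^'n. mixed_disc i B / mixed_disc (i + 1) B"
  have i: "i < CARD('n)"
    using assms(3) by (metis One_nat_def Suc_pred le_imp_less_Suc zero_less_card_finite)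
  obtain xs where len: "length xs = CARD('n)" and pos: "\<forall>x\<in>set xs. 0 < x"
    and det: "\<And>\<mu>. det (A + \<mu> *\<^sub>R mat 1) = (\<Prod>x\<leftarrow>xs. x + \<mu>)"
    using symmetric_posdef_det_factors[OF assms(1,2)] by blast
  define f where "f s = coeff_mean (map ((+) s) xs) i / coeff_mean (map ((+) s) xs) (i + 1)" for s
  have ratio: "?R ((1 - t) *\<^sub>R A + t *\<^sub>R (r *\<^sub>R mat 1)) = (1 - t) * f (t * r / (1 - t))"
    if "t < 1" for t
    using mixed_disc_ratio_affine[OF len det i, of "1 - t" "t * r"] that by (simp add: f_def)
  have ratio_A: "?R A = f 0"
    using mixed_disc_ratio_affine[OF len det i, of 1 0] by (simp add: f_def)
  have f_0: "f 0 = coeff_mean xs i / coeff_mean xs (i + 1)"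
    by (simp add: f_def map_idI)
  have ratio_r: "?R (r *\<^sub>R mat 1) = r"
    using mixed_disc_ratio_scalar[OF i] assms(4) by simp
  \<comment> \<open>After division by \<open>1 - t > 0\<close> the claim reads
    \<open>f 0 + s \<le> f s\<close> with \<open>s = t * r / (1 - t)\<close>.\<close>
  have rhs: "(1 - t) * f 0 + t * r = (1 - t) * (f 0 + t * r / (1 - t))" if "t < 1" for t
    using that by (simp add: field_simps)
  have ineq: "(1 - t) * ?R A + t * ?R (r *\<^sub>R mat 1) \<le> ?R ((1 - t) *\<^sub>R A + t *\<^sub>R (r *\<^sub>R mat 1))"
    if t: "t \<in> {0<..<1}" for t
  proof -
    have "f 0 + t * r / (1 - t) \<le> f (t * r / (1 - t))"
      \<comment> \<open>\<open>f_0\<close> goes first, so that \<open>f 0\<close> becomes a ratio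
        for \<open>xs\<close> itself and not for a list shifted by zero.\<close>
      unfolding f_0 unfolding f_def using t assms(4) pos i len
      by (intro coeff_mean_ratio_shift) auto
    then show ?thesis
      unfolding ratio_A ratio_r using t
      by (simp only: ratio rhs greaterThanLessThan_iff) (auto intro: mult_left_mono)
  qed
  have scalar: "\<exists>\<alpha>>0. A = \<alpha> *\<^sub>R mat 1"
    if t: "t \<in> {0<..<1}" and i2: "i < CARD('n) - 1"
      and eq: "?R ((1 - t) *\<^sub>R A + t *\<^sub>R (r *\<^sub>R mat 1)) = (1 - t) * ?R A + t * ?R (r *\<^sub>R mat 1)" for t
  proof -
    have "\<exists>c. xs = replicate (length xs) c"
    proof (rule ccontr)
      assume "\<nexists>c. xs = replicate (length xs) c"
      then have "f 0 + t * r / (1 - t) < f (t * r / (1 - t))"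
        unfolding f_0 unfolding f_def using t assms(4) pos i2 len
        by (intro coeff_mean_ratio_shift_strict) auto
      moreover have "(1 - t) * f (t * r / (1 - t)) = (1 - t) * (f 0 + t * r / (1 - t))"
        using eq t by (simp only: ratio ratio_A ratio_r rhs greaterThanLessThan_iff)
      ultimately show False using t by simp
    qed
    then obtain c where c: "xs = replicate CARD('n) c" using len by auto
    have "0 < c" using pos by (subst (asm) c) auto
    moreover have "A = c *\<^sub>R mat 1"
      using assms(1) by (rule symmetric_det_power_imp_scalar) (simp add: det c map_replicate prod_list_replicate)
    ultimately show ?thesis by blast
  qed
  have eq_scalar: "?R ((1 - t) *\<^sub>R A + t *\<^sub>R (r *\<^sub>R mat 1)) = (1 - t) * ?R A + t * ?R (r *\<^sub>R mat 1)"
    if \<alpha>: "0 < \<alpha>" "A = \<alpha> *\<^sub>R mat 1" and t: "t \<in> {0<..<1}" for \<alpha> t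
  proof -
    \<comment> \<open>The combination is again scalar, and the ratio of a scalar matrix is its
      scalar, so equality holds for every \<open>t\<close>.\<close>
    have "(1 - t) *\<^sub>R A + t *\<^sub>R (r *\<^sub>R mat 1) = ((1 - t) * \<alpha> + t * r) *\<^sub>R mat 1"
      by (simp add: \<alpha>(2) scaleR_add_left)
    moreover have "0 < (1 - t) * \<alpha> + t * r"
      using \<alpha>(1) t assms(4) by (intro add_pos_pos mult_pos_pos) auto
    ultimately show ?thesis
      using mixed_disc_ratio_scalar[OF i] \<alpha> ratio_r by simp
  qed
  \<comment> \<open>A witness for the existential over \<open>t\<close> when \<open>A\<close> is
    scalar.\<close>
  have "(1 / 2 :: real) \<in> {0<..<1}" by simp
  with ineq scalar eq_scalar show ?thesis by blast
qed

end
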